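(* Let $(L,[\cdot,\cdot]_1,[\cdot,\cdot]_2,\delta_1,\delta_2)$ be a compatible LieDer pair and let $R:L\to L$ be a Rota-Baxter operator of weight $\lambda=0$ (on both Lie algebras $(L,[\cdot,\cdot]_1)$ and $(L,[\cdot,\cdot]_2)$) such that $R\circ\delta_i=\delta_i\circ R$ for $i\in\{1,2\}$. Define, for $i\in\{1,2\}$ and $x,y\in L$, $$x\circ_iy=[Rx,y]_i.$$ Then $(L,\circ_1,\circ_2,\delta_1,\delta_2)$ is a compatible pre-LieDer pair.
   Context: All vector spaces are over a field $\mathbb{K}$ of characteristic $0$. A LieDer pair $(L,[\cdot,\cdot],\delta)$ is a Lie algebra with a linear map $\delta:L\to L$ such that $\delta[x,y]=[\delta x,y]+[x,\delta y]$. A compatible LieDer pair $(L,[\cdot,\cdot]_1,[\cdot,\cdot]_2,\delta_1,\delta_2)$ consists of two LieDer pairs $(L,[\cdot,\cdot]_1,\delta_1)$, $(L,[\cdot,\cdot]_2,\delta_2)$ on the same vector space such that for all $x,y,z\in L$ (with $\circlearrowleft_{x,y,z}$ the sum over cyclic permutations of $x,y,z$): (1) $\circlearrowleft_{x,y,z}[x,[y,z]_1]_2+\circlearrowleft_{x,y,z}[x,[y,z]_2]_1=0$; (2) $\delta_1[x,y]_2+\delta_2[x,y]_1=[\delta_1x,y]_2+[x,\delta_1y]_2+[\delta_2x,y]_1+[x,\delta_2y]_1$. A linear map $R$ is a Rota-Baxter operator of weight $0$ on a Lie algebra $(L,[\cdot,\cdot])$ if $[Rx,Ry]=R([Rx,y]+[x,Ry])$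 for all $x,y\in L$. A pre-Lie algebra $(L,\circ)$ is a vector space with a bilinear operation such that $(x\circ y)\circ z-x\circ(y\circ z)=(y\circ x)\circ z-y\circ(x\circ z)$. A pre-LieDer pair $(L,\circ,\delta)$ is a pre-Lie algebra with a linear map $\delta$ such that $\delta(x\circ y)=\delta x\circ y+x\circ\delta y$. A compatible pre-LieDer pair $(L,\circ_1,\circ_2,\delta_1,\delta_2)$ consists of two pre-LieDer pairs $(L,\circ_1,\delta_1)$, $(L,\circ_2,\delta_2)$ such that for all $x,y,z\in L$: $x\circ_1(y\circ_2z)+x\circ_2(y\circ_1z)-(x\circ_2y)\circ_1z-(x\circ_1y)\circ_2z=y\circ_1(x\circ_2z)+y\circ_2(x\circ_1z)-(y\circ_2x)\circ_1z-(y\circ_1x)\circ_2z$ and $\delta_1(x\circ_2y)+\delta_2(x\circ_1y)=\delta_1x\circ_2y+x\circ_2\delta_1y+\delta_2x\circ_1y+x\circ_1\delta_2y$. *)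

theory Defs
  imports Complex_Main
begin

text \<open>
  The underlying vector space \<open>L\<close> is the whole type \<open>'v\<close>, with scalar multiplication \<open>scale\<close> over
  a field \<open>'k\<close> of characteristic 0.
\<close>

locale bilinear_operation = vector_space scale
  for scale :: "'k::field_char_0 \<Rightarrow> 'v::ab_group_add \<Rightarrow> 'v" +
  fixes mult :: "'v \<Rightarrow> 'v \<Rightarrow> 'v"
  assumes linear_left: "Vector_Spaces.linear scale scale (\<lambda>x. mult x y)"
    and linear_right: "Vector_Spaces.linear scale scale (\<lambda>y. mult x y)"

locale lie_algebra = bilinear_operation scale br
  for scale :: "'k::field_char_0 \<Rightarrow> 'v::ab_group_add \<Rightarrow> 'v"
    and br :: "'v \<Rightarrow> 'v \<Rightarrow> 'v" +
  assumes alternating: "br x x = 0"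
    and jacobi: "br x (br y z) + br y (br z x) + br z (br x y) = 0"

locale lie_der_pair = lie_algebra scale br
  for scale :: "'k::field_char_0 \<Rightarrow> 'v::ab_group_add \<Rightarrow> 'v"
    and br :: "'v \<Rightarrow> 'v \<Rightarrow> 'v" +
  fixes \<delta> :: "'v \<Rightarrow> 'v"
  assumes linear_der: "Vector_Spaces.linear scale scale \<delta>"
    and der: "\<delta> (br x y) = br (\<delta> x) y + br x (\<delta> y)"

locale compatible_lie_der_pair =
  pair1: lie_der_pair scale br1 \<delta>1 + pair2: lie_der_pair scale br2 \<delta>2
  for scale :: "'k::field_char_0 \<Rightarrow> 'v::ab_group_add \<Rightarrow> 'v"
    and br1 br2 :: "'v \<Rightarrow> 'v \<Rightarrow> 'v"
    and \<delta>1 \<delta>2 :: "'v \<Rightarrow> 'v" +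
  assumes compatible_jacobi:
      "(br2 x (br1 y z) + br2 y (br1 z x) + br2 z (br1 x y)) +
       (br1 x (br2 y z) + br1 y (br2 z x) + br1 z (br2 x y)) = 0"
    and compatible_der:
      "\<delta>1 (br2 x y) + \<delta>2 (br1 x y) =
       br2 (\<delta>1 x) y + br2 x (\<delta>1 y) + br1 (\<delta>2 x) y + br1 x (\<delta>2 y)"

locale rota_baxter_weight_zero = lie_algebra scale br
  for scale :: "'k::field_char_0 \<Rightarrow> 'v::ab_group_add \<Rightarrow> 'v"
    and br :: "'v \<Rightarrow> 'v \<Rightarrow> 'v" +
  fixes R :: "'v \<Rightarrow> 'v"
  assumes linear_R: "Vector_Spaces.linear scale scale R"
    and rota_baxter: "br (R x) (R y) = R (br (R x) y + br x (R y))"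

locale pre_lie_algebra = bilinear_operation scale mult
  for scale :: "'k::field_char_0 \<Rightarrow> 'v::ab_group_add \<Rightarrow> 'v"
    and mult :: "'v \<Rightarrow> 'v \<Rightarrow> 'v" +
  assumes pre_lie:
    "mult (mult x y) z - mult x (mult y z) = mult (mult y x) z - mult y (mult x z)"

locale pre_lie_der_pair = pre_lie_algebra scale mult
  for scale :: "'k::field_char_0 \<Rightarrow> 'v::ab_group_add \<Rightarrow> 'v"
    and mult :: "'v \<Rightarrow> 'v \<Rightarrow> 'v" +
  fixes \<delta> :: "'v \<Rightarrow> 'v"
  assumes linear_der: "Vector_Spaces.linear scale scale \<delta>"
    and der: "\<delta> (mult x y) = mult (\<delta> x) y + mult x (\<delta> y)"

locale compatible_pre_lie_der_pair =
  pair1: pre_lie_der_pair scale mult1 \<delta>1 + pair2: pre_lie_der_pair scale mult2 \<delta>2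
  for scale :: "'k::field_char_0 \<Rightarrow> 'v::ab_group_add \<Rightarrow> 'v"
    and mult1 mult2 :: "'v \<Rightarrow> 'v \<Rightarrow> 'v"
    and \<delta>1 \<delta>2 :: "'v \<Rightarrow> 'v" +
  assumes compatible_pre_lie:
      "mult1 x (mult2 y z) + mult2 x (mult1 y z) - mult1 (mult2 x y) z - mult2 (mult1 x y) z =
       mult1 y (mult2 x z) + mult2 y (mult1 x z) - mult1 (mult2 y x) z - mult2 (mult1 y x) z"
    and compatible_der:
      "\<delta>1 (mult2 x y) + \<delta>2 (mult1 x y) =
       mult2 (\<delta>1 x) y + mult2 x (\<delta>1 y) + mult1 (\<delta>2 x) y + mult1 x (\<delta>2 y)"

end

(* Since R([Rx,y] - [Ry,x]) = [Rx,Ry], the commutator of the new product is sent by R to the bracket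
   of the images. The (mixed) pre-Lie identities at x, y, z are therefore the (mixed) Jacobi
   identities at Rx, Ry, z. In the mixed case R only meets a single bracket at a time, so
   Rota-Baxter identities for the separate brackets suffice. *)

theory Submission
  imports Defs
begin

context bilinear_operation
begin

lemma mult_add_left: "mult (x + y) z = mult x z + mult y z"
  using linear_left by (rule module_hom.add[OF Vector_Spaces.linear.axioms(3)])

lemma mult_add_right: "mult x (y + z) = mult x y + mult x z"
  using linear_right by (rule module_hom.add[OF Vector_Spaces.linear.axioms(3)])

lemma mult_minus_right: "mult x (- y) = - mult x y"
  using linear_right by (rule module_hom.neg[OF Vector_Spaces.linear.axioms(3)])

lemma mult_diff_left: "mult (x - y) z = mult x z - mult y z"
  by (metis add_diff_cancel diff_add_cancel mult_add_left)

text \<open>Applied with \<open>f = R\<close>, this supplies the bilinearity of the new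
  product.\<close>

lemma bilinear_operation_precompose_left:
  assumes "Vector_Spaces.linear scale scale f"
  shows "bilinear_operation scale (\<lambda>x y. mult (f x) y)"
proof (intro bilinear_operation.intro bilinear_operation_axioms.intro)
  show "vector_space scale"
    by (rule vector_space_axioms)
  show "Vector_Spaces.linear scale scale (\<lambda>x. mult (f x) y)" for y
    using Vector_Spaces.linear_compose[OF assms linear_left] by (simp add: o_def)
  show "Vector_Spaces.linear scale scale (\<lambda>y. mult (f x) y)" for x
    by (rule linear_right)
qed

end

text \<open>Polarisation: when the alternating law at \<open>y + x\<close> is expanded, the two
  squares vanish and only the mixed terms remain.\<close>

lemma (in lie_algebra) antisymmetric: "br x y = - br y x"
proof -
  have "br x y + br y x = 0"
    using alternating[of "y + x"]
    by (simp only: mult_add_left mult_add_right alternating[of x] alternating[of y]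
        add_0_left add_0_right)
  then show ?thesis
    by (simp only: eq_neg_iff_add_eq_0)
qed

text \<open>By linearity the left side is \<open>R\<close> of a difference, and antisymmetry turns
  \<open>- br (R y) x\<close> into \<open>br x (R y)\<close>, which is the argument of
  \<open>R\<close> in the Rota-Baxter identity.\<close>

lemma (in rota_baxter_weight_zero) R_diff_eq_bracket:
  "R (br (R x) y) - R (br (R y) x) = br (R x) (R y)"
proof -
  have "R (br (R x) y) - R (br (R y) x) = R (br (R x) y - br (R y) x)"
    using linear_R by (metis module_hom.diff Vector_Spaces.linear.axioms(3))
  also have "br (R x) y - br (R y) x = br (R x) y + br x (R y)"
    using antisymmetric[of "R y" x] by simp
  finally show ?thesis
    by (simp only: rota_baxter)
qed

lemma (in rota_baxter_weight_zero) pre_lie_algebra_rota_baxter: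
  "pre_lie_algebra scale (\<lambda>x y. br (R x) y)"
proof (intro pre_lie_algebra.intro pre_lie_algebra_axioms.intro)
  show "bilinear_operation scale (\<lambda>x y. br (R x) y)"
    by (rule bilinear_operation_precompose_left[OF linear_R])
next
  fix x y z
  have "br (R (br (R x) y)) z - br (R (br (R y) x)) z = br (br (R x) (R y)) z"
    by (simp only: mult_diff_left[symmetric] R_diff_eq_bracket)
  \<comment> \<open>The Jacobi identity solved for its double bracket: \<open>br (R x)\<close> and
    \<open>br (R y)\<close> act on \<open>z\<close>, and their commutator is the action of
    \<open>br (R x) (R y)\<close>.\<close>
  also have "\<dots> = br (R x) (br (R y) z) - br (R y) (br (R x) z)"
    using jacobi[of "R x" "R y" z] antisymmetric[of z "R x"] antisymmetric[of "br (R x) (R y)" z]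
    by (simp add: mult_minus_right algebra_simps)
  finally show "br (R (br (R x) y)) z - br (R x) (br (R y) z)
      = br (R (br (R y) x)) z - br (R y) (br (R x) z)"
    by (simp add: algebra_simps)
qed

text \<open>The Leibniz rule for \<open>br\<close> at \<open>R x\<close> and \<open>y\<close>
  produces \<open>br (\<delta> (R x)) y\<close>; commutation of \<open>R\<close> with
  \<open>\<delta>\<close> makes this the new product of \<open>\<delta> x\<close> and
  \<open>y\<close>.\<close>

lemma pre_lie_der_pair_rota_baxter:
  assumes "lie_der_pair scale br \<delta>" "rota_baxter_weight_zero scale br R"
    and comm: "R \<circ> \<delta> = \<delta> \<circ> R"
  shows "pre_lie_der_pair scale (\<lambda>x y. br (R x) y) \<delta>"
proof -
  interpret lie_der_pair scale br \<delta> by fact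
  have "R (\<delta> x) = \<delta> (R x)" for x
    using comm by (rule comp_eq_dest)
  then show ?thesis
    using rota_baxter_weight_zero.pre_lie_algebra_rota_baxter[OF assms(2)]
    by (intro pre_lie_der_pair.intro pre_lie_der_pair_axioms.intro) (simp_all add: der linear_der)
qed

theorem proposition4p11:
  fixes scale :: "'k::field_char_0 \<Rightarrow> 'v::ab_group_add \<Rightarrow> 'v"
    and br1 br2 :: "'v \<Rightarrow> 'v \<Rightarrow> 'v"
    and \<delta>1 \<delta>2 R :: "'v \<Rightarrow> 'v"
  assumes "compatible_lie_der_pair scale br1 br2 \<delta>1 \<delta>2"
    and "rota_baxter_weight_zero scale br1 R"
    and "rota_baxter_weight_zero scale br2 R"
    and "R \<circ> \<delta>1 = \<delta>1 \<circ> R"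
    and "R \<circ> \<delta>2 = \<delta>2 \<circ> R"
  shows "compatible_pre_lie_der_pair scale (\<lambda>x y. br1 (R x) y) (\<lambda>x y. br2 (R x) y) \<delta>1 \<delta>2"
proof -
  interpret compatible_lie_der_pair scale br1 br2 \<delta>1 \<delta>2 by fact
  interpret RB1: rota_baxter_weight_zero scale br1 R by fact
  interpret RB2: rota_baxter_weight_zero scale br2 R by fact
  have comm: "R (\<delta>1 x) = \<delta>1 (R x)" "R (\<delta>2 x) = \<delta>2 (R x)" for x
    using assms(4,5) by (auto dest: comp_eq_dest)
  show ?thesis
  proof (intro compatible_pre_lie_der_pair.intro compatible_pre_lie_der_pair_axioms.intro)
    show "pre_lie_der_pair scale (\<lambda>x y. br1 (R x) y) \<delta>1"
      using pair1.lie_der_pair_axioms assms(2,4) by (rule pre_lie_der_pair_rota_baxter)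
    show "pre_lie_der_pair scale (\<lambda>x y. br2 (R x) y) \<delta>2"
      using pair2.lie_der_pair_axioms assms(3,5) by (rule pre_lie_der_pair_rota_baxter)
  next
    fix x y z
    \<comment> \<open>The four terms are paired by the bracket inside \<open>R\<close>. Linearity of
      the outer bracket in its left slot merges each pair, and the Rota-Baxter identity of the inner
      bracket then removes the outer \<open>R\<close>.\<close>
    have "br1 (R (br2 (R x) y)) z - br1 (R (br2 (R y) x)) z
        + (br2 (R (br1 (R x) y)) z - br2 (R (br1 (R y) x)) z)
      = br1 (br2 (R x) (R y)) z + br2 (br1 (R x) (R y)) z"
      by (simp only: pair1.mult_diff_left[symmetric] pair2.mult_diff_left[symmetric]
          RB1.R_diff_eq_bracket RB2.R_diff_eq_bracket)
    \<comment> \<open>The mixed Jacobi identity determines only the sum of the two mixed double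
      brackets, so both pairs have to be treated together.\<close>
    also have "\<dots> = br1 (R x) (br2 (R y) z) + br2 (R x) (br1 (R y) z)
        - br1 (R y) (br2 (R x) z) - br2 (R y) (br1 (R x) z)"
      using compatible_jacobi[of "R x" "R y" z]
        pair1.antisymmetric[of z "R x"] pair2.antisymmetric[of z "R x"]
        pair1.antisymmetric[of "br2 (R x) (R y)" z] pair2.antisymmetric[of "br1 (R x) (R y)" z]
      by (simp add: pair1.mult_minus_right pair2.mult_minus_right algebra_simps)
    finally show "br1 (R x) (br2 (R y) z) + br2 (R x) (br1 (R y) z)
          - br1 (R (br2 (R x) y)) z - br2 (R (br1 (R x) y)) z
        = br1 (R y) (br2 (R x) z) + br2 (R y) (br1 (R x) z)
          - br1 (R (br2 (R y) x)) z - br2 (R (br1 (R y) x)) z"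
      by (simp add: algebra_simps)
  next
    fix x y
    show "\<delta>1 (br2 (R x) y) + \<delta>2 (br1 (R x) y) =
        br2 (R (\<delta>1 x)) y + br2 (R x) (\<delta>1 y) + br1 (R (\<delta>2 x)) y + br1 (R x) (\<delta>2 y)"
      \<comment> \<open>Once \<open>R\<close> is moved past each derivation, this is the mixed
        Leibniz rule at \<open>R x\<close> and \<open>y\<close>.\<close>
      by (simp only: comm compatible_der)
  qed
qed

end
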